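(* The function $$\mathscr{FW}(x):=\min_{\tau\in\mathcal{T}_x}\Delta(\tau)-\min_{\tau\in\mathcal{T}}\Delta(\tau),\qquad x\in V,$$ is always an element of $\mathcal{W}_0$, the set of normalized solutions of the discrete Hamilton–Jacobi equation. That is, $\min_{x\in V}\mathscr{FW}(x)=0$ and $$\mathscr{FW}(x)+\min_{y:(x,y)\in E}\Delta(x,y)=\min_{y:(y,x)\in E}\{\mathscr{FW}(y)+\Delta(y,x)\}\qquad\forall x\in V.$$
   Context: $\mathcal{G}=(V,E)$ is a finite, strongly connected directed graph without loops, and $\Delta:E\to[0,+\infty)$ is a weight function. Standing assumption: for every $x\in V$ there is exactly one edge $(x,y)\in E$ exiting from $x$ with $\Delta(x,y)=0$ (so the minimum on the left-hand side of the equation is $0$). An arborescence directed toward $x\in V$ is a spanning subgraph $\tau$ of $\mathcal{G}$ such that each vertex $y\ne x$ has exactly one exiting edge in $\tau$, there is no edge of $\tau$ exiting from $x$, and from every $y\in V$ there is a unique directed path in $\tau$ to $x$. $\mathcal{T}_x$ is the set of arborescences of $\mathcal{G}$ directed toward $x$ and $\mathcal{T}=\bigcup_{x\in V}\mathcal{T}_x$. For $\tau\in\mathcal{T}$, $\Delta(\tau):=\sum_{e\in\tau}\Delta(e)$, the sum over the directed edges of $\tau$. $\mathcal{W}_0$ is the set of solutions $W:V\to\mathbb{R}$ of the discrete Hamilton–Jacobi equation with $\inf_{x\in V}W(x)=0$. *)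

theory Defs
  imports "Graph_Theory.Digraph_Component" "Graph_Theory.Weighted_Graph"
begin

text \<open>
  An edge is the pair (source, target). Paths are \<^const>\<open>pre_digraph.apath\<close>, that is, without
  repeated vertices; the empty path from \<open>x\<close> to \<open>x\<close> is one of them.
\<close>

definition arborescences :: "'a pair_pre_digraph \<Rightarrow> 'a \<Rightarrow> 'a pair_pre_digraph set" where
  "arborescences G x = {\<tau>.
     x \<in> pverts G \<and>
     spanning (with_proj \<tau>) (with_proj G) \<and>
     (\<forall>y \<in> pverts G. y \<noteq> x \<longrightarrow> (\<exists>!e. e \<in> parcs \<tau> \<and> fst e = y)) \<and>
     (\<forall>e \<in> parcs \<tau>. fst e \<noteq> x) \<and>
     (\<forall>y \<in> pverts G. \<exists>!p. pre_digraph.apath (with_proj \<tau>) y p x)}"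

definition all_arborescences :: "'a pair_pre_digraph \<Rightarrow> 'a pair_pre_digraph set" where
  "all_arborescences G = (\<Union>x \<in> pverts G. arborescences G x)"

definition weight :: "('a \<times> 'a) weight_fun \<Rightarrow> 'a pair_pre_digraph \<Rightarrow> real" where
  "weight \<Delta> \<tau> = (\<Sum>e \<in> parcs \<tau>. \<Delta> e)"

text \<open>
  Functions on the vertex set are total functions on the ambient type; their values outside
  \<^term>\<open>pverts G\<close> are irrelevant.
\<close>

definition hamilton_jacobi ::
    "'a pair_pre_digraph \<Rightarrow> ('a \<times> 'a) weight_fun \<Rightarrow> ('a \<Rightarrow> real) \<Rightarrow> bool" where
  "hamilton_jacobi G \<Delta> W \<longleftrightarrow>
     (\<forall>x \<in> pverts G.
        W x + Min {\<Delta> (x, y) | y. (x, y) \<in> parcs G} =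
        Min {W y + \<Delta> (y, x) | y. (y, x) \<in> parcs G})"

definition normalized_solutions ::
    "'a pair_pre_digraph \<Rightarrow> ('a \<times> 'a) weight_fun \<Rightarrow> ('a \<Rightarrow> real) set" where
  "normalized_solutions G \<Delta> = {W. hamilton_jacobi G \<Delta> W \<and> (INF x \<in> pverts G. W x) = 0}"

definition FW :: "'a pair_pre_digraph \<Rightarrow> ('a \<times> 'a) weight_fun \<Rightarrow> 'a \<Rightarrow> real" where
  "FW G \<Delta> x = Min (weight \<Delta> ` arborescences G x) - Min (weight \<Delta> ` all_arborescences G)"

end

theory Submission
  imports Defs
begin

text \<open>
  Adding an edge \<open>(r, n)\<close> to an arborescence rooted at \<open>r\<close> closes exactly one cycle; deleting
  the edge of that cycle that leaves a vertex \<open>y\<close> gives an arborescence rooted at \<open>y\<close>.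
  Write \<open>T x\<close> for the minimal weight of an arborescence directed toward \<open>x\<close>.
  Rerooting along an edge \<open>(y, x)\<close> shows \<open>T x \<le> T y + \<Delta> (y, x)\<close>, since the deleted edge has
  nonnegative weight. Conversely, adding the zero edge that leaves \<open>x\<close> to an optimal arborescence
  toward \<open>x\<close> and deleting the edge \<open>(y, x)\<close> of the resulting cycle shows
  \<open>T y + \<Delta> (y, x) \<le> T x\<close>.
\<close>

section \<open>Arborescences in terms of the edge relation\<close>

text \<open>With at most one edge leaving each vertex, two walks from the same start cannot diverge.
  Since no edge leaves \<open>x\<close>, neither walk can continue after reaching it, so they also
  stop together.\<close>

lemma (in wf_digraph) awalk_unique:
  assumes "awalk u p x" "awalk u q x"
    and "inj_on (tail G) (arcs G)" "\<forall>e \<in> arcs G. tail G e \<noteq> x"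
  shows "p = q"
  using assms(1,2)
proof (induction p arbitrary: u q)
  case Nil
  then show ?case using assms(4) by (cases q) (auto simp: awalk_simps)
next
  case (Cons e p)
  then obtain e' q' where q: "q = e' # q'"
    using assms(4) by (cases q) (auto simp: awalk_simps)
  then have "e' = e"
    using Cons.prems assms(3) by (auto simp: awalk_simps dest: inj_onD)
  then show ?case using Cons q by (auto simp: awalk_simps)
qed

text \<open>Trades the unique-path condition for plain reachability: a reachable root gives some
  path, and \<open>awalk_unique\<close> makes it the only one. The later arguments can then work
  with the edge relation and \<open>rtrancl\<close> alone.\<close>

lemma arborescences_iff:
  assumes "pair_wf_digraph G"
  shows "\<tau> \<in> arborescences G x \<longleftrightarrow>
    x \<in> pverts G \<and> pverts \<tau> = pverts G \<and> parcs \<tau> \<subseteq> parcs G \<and>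
    (\<forall>y \<in> pverts G. y \<noteq> x \<longrightarrow> (\<exists>z. (y, z) \<in> parcs \<tau>)) \<and>
    (\<forall>y z z'. (y, z) \<in> parcs \<tau> \<longrightarrow> (y, z') \<in> parcs \<tau> \<longrightarrow> z = z') \<and>
    (\<forall>z. (x, z) \<notin> parcs \<tau>) \<and>
    (\<forall>y \<in> pverts G. (y, x) \<in> (parcs \<tau>)\<^sup>*)" (is "?L \<longleftrightarrow> ?R")
proof -
  interpret G: pair_wf_digraph G by fact
  have wf: "pair_wf_digraph \<tau>" if "pverts \<tau> = pverts G" "parcs \<tau> \<subseteq> parcs G"
    using that by unfold_locales (blast intro: G.arc_fst_in_verts G.arc_snd_in_verts)+
  have span: "spanning (with_proj \<tau>) (with_proj G) \<longleftrightarrow>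
      pverts \<tau> = pverts G \<and> parcs \<tau> \<subseteq> parcs G"
    using wf assms by (auto simp: spanning_def subgraph_def wf_digraph_wp_iff compatible_def)
  show ?thesis
  proof
    assume L: ?L
    then have s: "pverts \<tau> = pverts G" "parcs \<tau> \<subseteq> parcs G"
      by (auto simp: arborescences_def span)
    interpret t: pair_wf_digraph \<tau> using wf s by blast
    have "(y, x) \<in> (parcs \<tau>)\<^sup>*" if "y \<in> pverts G" for y
    proof -
      have "\<exists>!p. t.apath y p x" using L that by (simp add: arborescences_def)
      then obtain p where "t.apath y p x" by blast
      then have "y \<rightarrow>\<^sup>*\<^bsub>with_proj \<tau>\<^esub> x" using t.reachable_apath by auto
      then show ?thesis using reachable_rtranclI by fastforce
    qed
    moreover have "z = z'" if "(y, z) \<in> parcs \<tau>" "(y, z') \<in> parcs \<tau>" for y z z'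
    proof -
      have "y \<in> pverts G" "y \<noteq> x"
        using that s(2) L G.in_arcsD1 by (auto simp: arborescences_def)
      then have "\<exists>!e. e \<in> parcs \<tau> \<and> fst e = y" using L by (simp add: arborescences_def)
      then show ?thesis using that by (metis fst_conv prod.inject)
    qed
    moreover have "\<exists>z. (y, z) \<in> parcs \<tau>" if "y \<in> pverts G" "y \<noteq> x" for y
    proof -
      have "\<exists>!e. e \<in> parcs \<tau> \<and> fst e = y" using L that by (simp add: arborescences_def)
      then show ?thesis by (metis prod.collapse)
    qed
    moreover have "x \<in> pverts G" "\<forall>z. (x, z) \<notin> parcs \<tau>"
      using L by (auto simp: arborescences_def)
    ultimately show ?R using s by blast
  next
    assume R: ?R
    interpret t: pair_wf_digraph \<tau> using wf R by blast
    have inj: "inj_on fst (parcs \<tau>)" using R by (auto simp: inj_on_def)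
    have root: "\<forall>e \<in> parcs \<tau>. fst e \<noteq> x" using R by auto
    have "\<exists>!p. t.apath y p x" if "y \<in> pverts G" for y
    proof -
      have "(y, x) \<in> (parcs \<tau>)\<^sup>*" "y \<in> pverts \<tau>" using R that by auto
      then have "y \<rightarrow>\<^sup>*\<^bsub>with_proj \<tau>\<^esub> x" using t.reachable_conv' by auto
      then obtain p where "t.apath y p x" using t.reachable_apath by auto
      moreover have "q = p" if "t.apath y q x" for q
        using t.awalk_unique[OF t.awalkI_apath t.awalkI_apath inj root] that \<open>t.apath y p x\<close> .
      ultimately show ?thesis by blast
    qed
    moreover have "\<exists>!e. e \<in> parcs \<tau> \<and> fst e = y" if yV: "y \<in> pverts G" and yx: "y \<noteq> x" for y
    proof -
      obtain z where z: "(y, z) \<in> parcs \<tau>" using R yV yx by blast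
      show ?thesis
      proof (rule ex1I[of _ "(y, z)"])
        fix e assume "e \<in> parcs \<tau> \<and> fst e = y"
        then show "e = (y, z)" using inj z by (auto simp: inj_on_def)
      qed (use z in simp)
    qed
    ultimately show ?L using R root span by (auto simp: arborescences_def)
  qed
qed

section \<open>Exchanging one edge for another\<close>

text \<open>A path to \<open>y\<close> may be cut at its first visit to \<open>y\<close>, and before
  that visit it uses no edge leaving \<open>y\<close>.\<close>

lemma rtrancl_Diff_exit:
  assumes "(n, y) \<in> R\<^sup>*"
  shows "(n, y) \<in> (R - {(y, z)})\<^sup>*"
  using assms
proof (induction rule: converse_rtrancl_induct)
  case (step a b)
  then show ?case by (cases "a = y") (auto intro: converse_rtrancl_into_rtrancl)
qed simp

text \<open>The path from \<open>n\<close> to \<open>y\<close> survives the deletion, so the old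
  root \<open>r\<close> reaches \<open>y\<close> through the new edge. Any other vertex follows its
  old path toward \<open>r\<close>: either it meets \<open>y\<close> on the way, or it arrives at
  \<open>r\<close> and continues from there. The cycle is \<open>r\<close>, \<open>n\<close>, ...,
  \<open>y\<close>, \<open>z\<close>, ..., \<open>r\<close>, with \<open>n = y\<close>
  allowed.\<close>

lemma arborescence_exchange:
  assumes "pair_wf_digraph G" "\<tau> \<in> arborescences G r"
    and "(r, n) \<in> parcs G" "(n, y) \<in> (parcs \<tau>)\<^sup>*" "(y, z) \<in> parcs \<tau>"
  shows "\<lparr>pverts = pverts G, parcs = insert (r, n) (parcs \<tau> - {(y, z)})\<rparr> \<in> arborescences G y"
proof -
  interpret G: pair_wf_digraph G by fact
  note t = assms(2)[unfolded arborescences_iff[OF assms(1)]]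
  let ?R = "insert (r, n) (parcs \<tau> - {(y, z)})"
  have yr: "y \<noteq> r" using t assms(5) by blast
  have "(n, y) \<in> ?R\<^sup>*"
    using rtrancl_Diff_exit[OF assms(4), of z] rtrancl_mono[of "parcs \<tau> - {(y, z)}" ?R] by blast
  then have ry: "(r, y) \<in> ?R\<^sup>*" by (blast intro: converse_rtrancl_into_rtrancl)
  have "(v, y) \<in> ?R\<^sup>*" if "v \<in> pverts G" for v
  proof -
    have "(v, r) \<in> (parcs \<tau>)\<^sup>*" using t that by blast
    then show ?thesis
    proof (induction rule: converse_rtrancl_induct)
      case (step a b)
      \<comment> \<open>A step along the deleted edge starts at \<open>y\<close>, which is already
        the target.\<close>
      then show ?case by (cases "(a, b) = (y, z)") (auto intro: converse_rtrancl_into_rtrancl)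
    qed (rule ry)
  qed
  moreover have "y \<in> pverts G" using t assms(5) G.in_arcsD1 by blast
  moreover have "\<exists>w. (v, w) \<in> ?R" if "v \<in> pverts G" "v \<noteq> y" for v
    using t that by (cases "v = r") blast+
  ultimately show ?thesis
    unfolding arborescences_iff[OF assms(1)] using t assms(3,5) yr by auto
qed

lemma weight_exchange:
  assumes "finite (parcs \<tau>)" "e \<notin> parcs \<tau>" "f \<in> parcs \<tau>"
  shows "weight \<Delta> \<lparr>pverts = V, parcs = insert e (parcs \<tau> - {f})\<rparr> = weight \<Delta> \<tau> + \<Delta> e - \<Delta> f"
  using assms by (simp add: weight_def sum_diff1)

section \<open>Existence of minimal arborescences\<close>

text \<open>A shortest-path tree works: every vertex other than \<open>x\<close> picks an edge to a
  vertex strictly closer to \<open>x\<close>. Following these edges decreases the distance, so it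
  must end at \<open>x\<close>.\<close>

lemma arborescences_nonempty:
  assumes "pair_wf_digraph G" "strongly_connected (with_proj G)" "x \<in> pverts G"
  shows "arborescences G x \<noteq> {}"
proof -
  interpret G: pair_wf_digraph G by fact
  \<comment> \<open>The distance from \<open>y\<close> to \<open>x\<close>, counted in
    edges.\<close>
  define d where "d y = (LEAST n. (y, x) \<in> parcs G ^^ n)" for y
  have reach: "\<exists>n. (y, x) \<in> parcs G ^^ n" if "y \<in> pverts G" for y
  proof -
    have "y \<rightarrow>\<^sup>*\<^bsub>with_proj G\<^esub> x" using assms that by (auto simp: strongly_connected_def)
    then show ?thesis using reachable_rtranclI by (fastforce simp: rtrancl_power)
  qed
  have "\<exists>z. (y, z) \<in> parcs G \<and> d z < d y" if "y \<in> pverts G" "y \<noteq> x" for y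
  proof -
    have dy: "(y, x) \<in> parcs G ^^ d y"
      unfolding d_def using reach[OF that(1)] by (rule LeastI_ex)
    then obtain m where m: "d y = Suc m" using \<open>y \<noteq> x\<close> by (cases "d y") auto
    then obtain z where "(y, z) \<in> parcs G" "(z, x) \<in> parcs G ^^ m"
      using dy by (metis relpow_Suc_D2)
    moreover from this have "d z \<le> m" unfolding d_def by (simp add: Least_le)
    ultimately show ?thesis using m by auto
  qed
  then obtain f where f: "\<And>y. y \<in> pverts G \<Longrightarrow> y \<noteq> x \<Longrightarrow> (y, f y) \<in> parcs G \<and> d (f y) < d y"
    by metis
  let ?R = "(\<lambda>y. (y, f y)) ` (pverts G - {x})"
  have "(y, x) \<in> ?R\<^sup>*" if "y \<in> pverts G" for y
    using that
  proof (induction "d y" arbitrary: y rule: less_induct)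
    case less
    show ?case
    proof (cases "y = x")
      case False
      then have "(f y, x) \<in> ?R\<^sup>*" using less f[of y] G.in_arcsD2 by blast
      moreover have "(y, f y) \<in> ?R" using False less.prems by blast
      ultimately show ?thesis by (rule converse_rtrancl_into_rtrancl[rotated])
    qed simp
  qed
  then have "\<lparr>pverts = pverts G, parcs = ?R\<rparr> \<in> arborescences G x"
    unfolding arborescences_iff[OF assms(1)] using f assms(3) by auto
  then show ?thesis by blast
qed

text \<open>The vertex set being fixed by spanning, an arborescence is determined by its edge set, a
  subset of the finite set \<open>parcs G\<close>.\<close>

lemma finite_arborescences:
  assumes "pair_fin_digraph G"
  shows "finite (arborescences G x)"
proof -
  interpret G: pair_fin_digraph G by fact
  have "\<tau> \<in> (\<lambda>A. \<lparr>pverts = pverts G, parcs = A\<rparr>) ` Pow (parcs G)"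
    if "\<tau> \<in> arborescences G x" for \<tau>
    using that arborescences_iff[OF G.pair_wf_digraph_axioms, of \<tau> x]
    by (cases \<tau>) auto
  then show ?thesis
    using G.pair_finite_arcs by (meson finite_Pow_iff finite_imageI finite_subset subsetI)
qed

text \<open>This is \<open>T x\<close> of the sketch above; \<open>FW\<close> differs from it by an
  additive constant.\<close>

definition min_weight :: "'a pair_pre_digraph \<Rightarrow> ('a \<times> 'a) weight_fun \<Rightarrow> 'a \<Rightarrow> real" where
  "min_weight G \<Delta> x = Min (weight \<Delta> ` arborescences G x)"

lemma min_weight_le:
  assumes "pair_fin_digraph G" "\<tau> \<in> arborescences G x"
  shows "min_weight G \<Delta> x \<le> weight \<Delta> \<tau>"
  unfolding min_weight_def using assms(2) finite_arborescences[OF assms(1), of x]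
  by (intro Min_le) auto

lemma min_weight_attained:
  assumes "pair_fin_digraph G" "strongly_connected (with_proj G)" "x \<in> pverts G"
  obtains \<tau> where "\<tau> \<in> arborescences G x" "weight \<Delta> \<tau> = min_weight G \<Delta> x"
proof -
  interpret G: pair_fin_digraph G by fact
  have "min_weight G \<Delta> x \<in> weight \<Delta> ` arborescences G x"
    unfolding min_weight_def
    using finite_arborescences[OF assms(1)]
      arborescences_nonempty[OF G.pair_wf_digraph_axioms assms(2,3)]
    by (intro Min_in) auto
  then show thesis using that by auto
qed

text \<open>A minimum over a union is the minimum of the minima. It identifies the constant
  subtracted in \<open>FW\<close> as the least value of \<open>min_weight\<close>, which gives the
  normalization.\<close>

lemma min_weight_all:
  assumes "pair_fin_digraph G" "strongly_connected (with_proj G)"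
  shows "Min (weight \<Delta> ` all_arborescences G) = Min (min_weight G \<Delta> ` pverts G)"
proof -
  interpret G: pair_fin_digraph G by fact
  have ne: "pverts G \<noteq> {}" using assms(2) by (simp add: strongly_connected_def)
  have fin: "finite (weight \<Delta> ` all_arborescences G)"
    unfolding all_arborescences_def
    using G.pair_finite_verts finite_arborescences[OF assms(1)] by auto
  show ?thesis
  proof (rule antisym)
    have "Min (min_weight G \<Delta> ` pverts G) \<in> min_weight G \<Delta> ` pverts G"
      using ne G.pair_finite_verts by (intro Min_in) auto
    then obtain x where x: "x \<in> pverts G" "Min (min_weight G \<Delta> ` pverts G) = min_weight G \<Delta> x"
      by auto
    obtain \<tau> where "\<tau> \<in> arborescences G x" "weight \<Delta> \<tau> = min_weight G \<Delta> x"
      by (rule min_weight_attained[OF assms x(1)])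
    then show "Min (weight \<Delta> ` all_arborescences G) \<le> Min (min_weight G \<Delta> ` pverts G)"
      using x by (intro Min_le fin) (force simp: all_arborescences_def)
  next
    have "all_arborescences G \<noteq> {}"
      using ne arborescences_nonempty[OF G.pair_wf_digraph_axioms assms(2)]
      by (auto simp: all_arborescences_def)
    moreover have "Min (min_weight G \<Delta> ` pverts G) \<le> weight \<Delta> \<tau>"
      if "\<tau> \<in> all_arborescences G" for \<tau>
    proof -
      obtain x where "x \<in> pverts G" "\<tau> \<in> arborescences G x"
        using \<open>\<tau> \<in> all_arborescences G\<close> by (auto simp: all_arborescences_def)
      then have "min_weight G \<Delta> x \<le> weight \<Delta> \<tau>" "x \<in> pverts G"
        using min_weight_le[OF assms(1)] by auto
      then show ?thesis using G.pair_finite_verts by (meson Min_le finite_imageI imageI order_trans)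
    qed
    ultimately show "Min (min_weight G \<Delta> ` pverts G) \<le> Min (weight \<Delta> ` all_arborescences G)"
      using fin by (intro Min.boundedI) auto
  qed
qed

section \<open>The two Hamilton-Jacobi inequalities and the normalization\<close>

lemma min_weight_step_le:
  assumes "pair_digraph G" "strongly_connected (with_proj G)"
    and "\<forall>e \<in> parcs G. 0 \<le> \<Delta> e" "(y, x) \<in> parcs G"
  shows "min_weight G \<Delta> x \<le> min_weight G \<Delta> y + \<Delta> (y, x)"
proof -
  interpret G: pair_digraph G by fact
  obtain \<tau> where \<tau>: "\<tau> \<in> arborescences G y" "weight \<Delta> \<tau> = min_weight G \<Delta> y"
    by (rule min_weight_attained[OF G.pair_fin_digraph assms(2) G.in_arcsD1[OF assms(4)]])
  note t = \<tau>(1)[unfolded arborescences_iff[OF G.pair_wf_digraph]]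
  have "x \<in> pverts G" "x \<noteq> y" using assms(4) G.in_arcsD2 G.no_loops' by auto
  then obtain z where z: "(x, z) \<in> parcs \<tau>" using t by blast
  have "finite (parcs \<tau>)" using t G.pair_finite_arcs finite_subset by blast
  \<comment> \<open>The exchange is applied with the empty path: the added edge
    \<open>(y, x)\<close> ends at the new root itself.\<close>
  then have "min_weight G \<Delta> x \<le> weight \<Delta> \<tau> + \<Delta> (y, x) - \<Delta> (x, z)"
    using min_weight_le[OF G.pair_fin_digraph
        arborescence_exchange[OF G.pair_wf_digraph \<tau>(1) assms(4) rtrancl_refl z]]
      weight_exchange z t by metis
  moreover have "0 \<le> \<Delta> (x, z)" using z t assms(3) by blast
  ultimately show ?thesis using \<tau>(2) by linarith
qed

lemma min_weight_step_ge:
  assumes "pair_digraph G" "strongly_connected (with_proj G)"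
    and "(x, n) \<in> parcs G" "\<Delta> (x, n) = 0"
  obtains y where "(y, x) \<in> parcs G" "min_weight G \<Delta> y + \<Delta> (y, x) \<le> min_weight G \<Delta> x"
proof -
  interpret G: pair_digraph G by fact
  obtain \<tau> where \<tau>: "\<tau> \<in> arborescences G x" "weight \<Delta> \<tau> = min_weight G \<Delta> x"
    by (rule min_weight_attained[OF G.pair_fin_digraph assms(2) G.in_arcsD1[OF assms(3)]])
  note t = \<tau>(1)[unfolded arborescences_iff[OF G.pair_wf_digraph]]
  have "n \<in> pverts G" "n \<noteq> x" using assms(3) G.in_arcsD2 G.no_loops' by auto
  then have "(n, x) \<in> (parcs \<tau>)\<^sup>*" using t by blast
  \<comment> \<open>The last vertex before \<open>x\<close> on the path from \<open>n\<close>, hence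
    the predecessor of \<open>x\<close> on the cycle closed by \<open>(x, n)\<close>.\<close>
  with \<open>n \<noteq> x\<close> obtain y where y: "(n, y) \<in> (parcs \<tau>)\<^sup>*" "(y, x) \<in> parcs \<tau>"
    by (auto elim: rtranclE)
  have "finite (parcs \<tau>)" using t G.pair_finite_arcs finite_subset by blast
  then have "min_weight G \<Delta> y \<le> weight \<Delta> \<tau> + \<Delta> (x, n) - \<Delta> (y, x)"
    using min_weight_le[OF G.pair_fin_digraph
        arborescence_exchange[OF G.pair_wf_digraph \<tau>(1) assms(3) y]]
      weight_exchange y t by metis
  moreover have "(y, x) \<in> parcs G" using y t by blast
  ultimately show thesis using that \<tau>(2) assms(4) by fastforce
qed

theorem proposition4p8:
  fixes G :: "'a pair_pre_digraph" and \<Delta> :: "'a \<times> 'a \<Rightarrow> real"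
  assumes "pair_digraph G"
    and "strongly_connected (with_proj G)"
    and "\<forall>e \<in> parcs G. 0 \<le> \<Delta> e"
    and "\<forall>x \<in> pverts G. \<exists>!e. e \<in> parcs G \<and> fst e = x \<and> \<Delta> e = 0"
  shows "FW G \<Delta> \<in> normalized_solutions G \<Delta> \<and>
    Min (FW G \<Delta> ` pverts G) = 0 \<and>
    (\<forall>x \<in> pverts G.
       FW G \<Delta> x + Min {\<Delta> (x, y) | y. (x, y) \<in> parcs G} =
       Min {FW G \<Delta> y + \<Delta> (y, x) | y. (y, x) \<in> parcs G})"
proof -
  interpret G: pair_digraph G by fact
  have ne: "pverts G \<noteq> {}" using assms(2) by (simp add: strongly_connected_def)
  define c where "c = Min (min_weight G \<Delta> ` pverts G)"
  have FW: "FW G \<Delta> x = min_weight G \<Delta> x - c" for x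
    by (simp add: FW_def c_def min_weight_def min_weight_all[OF G.pair_fin_digraph assms(2),
          unfolded min_weight_def])
  \<comment> \<open>Both sets lie in the image of the finite vertex set under \<open>g\<close>;
    \<open>g\<close> is later instantiated by the expressions under \<open>Min\<close>.\<close>
  have fin: "finite {g y | y. (y, x) \<in> parcs G}" "finite {g y | y. (x, y) \<in> parcs G}"
    for g :: "'a \<Rightarrow> real" and x
    using G.in_arcsD1 G.in_arcsD2
    by (auto intro!: finite_subset[OF _ finite_imageI[OF G.pair_finite_verts, of g]])
  have min: "Min (FW G \<Delta> ` pverts G) = 0"
  proof (rule Min_eqI)
    have "c \<in> min_weight G \<Delta> ` pverts G"
      unfolding c_def using ne G.pair_finite_verts by (intro Min_in) auto
    then show "0 \<in> FW G \<Delta> ` pverts G" by (force simp: FW)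
  qed (use G.pair_finite_verts in \<open>auto simp: FW c_def\<close>)
  have hj: "FW G \<Delta> x + Min {\<Delta> (x, y) | y. (x, y) \<in> parcs G} =
      Min {FW G \<Delta> y + \<Delta> (y, x) | y. (y, x) \<in> parcs G}" if "x \<in> pverts G" for x
  proof -
    have "\<exists>!e. e \<in> parcs G \<and> fst e = x \<and> \<Delta> e = 0" using bspec[OF assms(4) that] .
    then obtain n where n: "(x, n) \<in> parcs G" "\<Delta> (x, n) = 0" by (metis prod.collapse)
    \<comment> \<open>Nonnegativity bounds the minimum from below, and the zero edge to
      \<open>n\<close> attains the bound.\<close>
    have "Min {\<Delta> (x, y) | y. (x, y) \<in> parcs G} = 0"
    proof (rule Min_eqI)
      show "finite {\<Delta> (x, y) | y. (x, y) \<in> parcs G}" by (rule fin(2))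
      show "0 \<in> {\<Delta> (x, y) | y. (x, y) \<in> parcs G}"
        unfolding mem_Collect_eq using n by (intro exI[of _ n]) simp
    qed (use assms(3) in auto)
    moreover have "Min {FW G \<Delta> y + \<Delta> (y, x) | y. (y, x) \<in> parcs G} = FW G \<Delta> x"
    proof (rule Min_eqI)
      show "finite {FW G \<Delta> y + \<Delta> (y, x) | y. (y, x) \<in> parcs G}" by (rule fin(1))
      have le: "FW G \<Delta> x \<le> FW G \<Delta> y + \<Delta> (y, x)" if "(y, x) \<in> parcs G" for y
        using min_weight_step_le[OF assms(1-3) that] by (simp add: FW)
      then show "FW G \<Delta> x \<le> a" if "a \<in> {FW G \<Delta> y + \<Delta> (y, x) | y. (y, x) \<in> parcs G}" for a
        using that by auto
      \<comment> \<open>The edge from this \<open>y\<close> attains the minimum: its inequality is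
        the reverse of \<open>le\<close>, and the constant \<open>c\<close> cancels in both.\<close>
      obtain y where y: "(y, x) \<in> parcs G" "FW G \<Delta> y + \<Delta> (y, x) \<le> FW G \<Delta> x"
        using min_weight_step_ge[where \<Delta> = \<Delta>, OF assms(1,2) n] by (auto simp: FW)
      then have "FW G \<Delta> x = FW G \<Delta> y + \<Delta> (y, x)" using le by force
      then show "FW G \<Delta> x \<in> {FW G \<Delta> y + \<Delta> (y, x) | y. (y, x) \<in> parcs G}" using y(1) by blast
    qed
    ultimately show ?thesis by simp
  qed
  \<comment> \<open>Over a finite nonempty vertex set the infimum is the minimum.\<close>
  have "(INF x \<in> pverts G. FW G \<Delta> x) = 0"
    using min ne G.pair_finite_verts by (simp add: cInf_eq_Min)
  then show ?thesis
    using min hj by (simp add: normalized_solutions_def hamilton_jacobi_def)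
qed

end
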